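(* Let $a,b>0$, $c=\sqrt{a^2+b^2}$, $t_0\in\mathbb{R}$, and $$f(t)=\frac{b(c\cosh t-a)}{\sqrt{c^2\cosh^2 t-a^2}},\qquad g(t)=\int_{t_0}^t\sqrt{c^2\cosh^2 z-a^2}\,dz-\frac{c\sinh t\,(c\cosh t-a)}{\sqrt{c^2\cosh^2 t-a^2}}.$$ Consider the nodoid $\mathbf{z}_1(t,v)=(f(t)\cos v,\,f(t)\sin v,\,g(t))$. With $h_1(t)=\dfrac{ab}{\sqrt{c^2\cosh^2 t-a^2}\,(c\cosh t+a)}$ one has $$(\mathbf{z}_1)_t=\big(c\sinh t\,h_1(t)\cos v,\;c\sinh t\,h_1(t)\sin v,\;b\,h_1(t)\big),\qquad (\mathbf{z}_1)_v=(-f(t)\sin v,\,f(t)\cos v,\,0),$$ and the unit normal is $$\mathbf{n}_1(t,v)=\frac{1}{\sqrt{c^2\cosh^2 t-a^2}}\,(-b\cos v,\,-b\sin v,\,c\sinh t).$$ The non-vanishing coefficients of the fundamental forms are $$E=\frac{a^2b^2}{(c\cosh t+a)^2},\quad G=\frac{b^2(c\cosh t-a)}{c\cosh t+a},\quad L=\frac{-ab^2c\cosh t}{(c^2\cosh^2 t-a^2)(c\cosh t+a)},\quad N=\frac{b^2}{c\cosh t+a},$$ and the principal, mean and Gaussian curvatures are $$k_1=\frac{-c\cosh t}{a(c\cosh t-a)},\quad k_2=\frac{1}{c\cosh t-a},\quad H=\frac{-1}{2a},\quad K=\frac{-c\cosh t}{a(c\cosh t-a)^2}.$$ In particular the mean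 curvature is constant, equal to minus the inverse of the distance $2a$ between the vertices of the hyperbola $x^2/a^2-y^2/b^2=1$. The geodesic curvature of the parallel at parameter $t$ is $k_g(t)=\dfrac{c\sinh t}{b(c\cosh t-a)}$. For $t_1<t_2$ and $v_1<v_2$, the total curvature over $[t_1,t_2]\times[v_1,v_2]$ is $$\int_{\mathbf{z}_1}K\,d\sigma=-c(v_2-v_1)\left.\frac{\sinh t}{\sqrt{c^2\cosh^2 t-a^2}}\right|_{t=t_1}^{t=t_2}.$$
   Context: For a surface of revolution $\mathbf{x}(t,v)=(f(t)\cos v,f(t)\sin v,g(t))$ with $f>0$, the unit normal is $\mathbf{n}=\frac{\mathbf{x}_t\times\mathbf{x}_v}{|\mathbf{x}_t\times\mathbf{x}_v|}$, and $E=\langle\mathbf{x}_t,\mathbf{x}_t\rangle$, $F=\langle\mathbf{x}_t,\mathbf{x}_v\rangle$, $G=\langle\mathbf{x}_v,\mathbf{x}_v\rangle$, $L=\langle\mathbf{x}_{tt},\mathbf{n}\rangle$, $M=\langle\mathbf{x}_{tv},\mathbf{n}\rangle$, $N=\langle\mathbf{x}_{vv},\mathbf{n}\rangle$. The principal curvatures are $k_1=L/E$, $k_2=N/G$, the mean curvature is $H=(k_1+k_2)/2$, and the Gaussian curvature is $K=LN/(EG)$. The geodesic curvature of an arc-length parametrized curve $\alpha$ in the surface is $k_g=\langle\alpha'',\mathbf{u}\rangle$, where $\mathbf{u}$ is the unit tangent vector to the surface with $\alpha'\times\mathbf{u}=\mathbf{n}$; the parallel at parameter $t$ is the curve $v\mapsto\mathbf{x}(t,v)$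 traversed with $v$ increasing. The area element is $d\sigma=|\mathbf{x}_t|\,|\mathbf{x}_v|\,dt\,dv$. *)

theory Defs
  imports "HOL-Analysis.Analysis"
begin

type_synonym surface = "real \<Rightarrow> real \<Rightarrow> real ^ 3"

definition surface_of_revolution :: "(real \<Rightarrow> real) \<Rightarrow> (real \<Rightarrow> real) \<Rightarrow> surface" where
  "surface_of_revolution f g t v = vector [f t * cos v, f t * sin v, g t]"

definition partial_t :: "surface \<Rightarrow> surface" where
  "partial_t x t v = vector_derivative (\<lambda>s. x s v) (at t)"

definition partial_v :: "surface \<Rightarrow> surface" where
  "partial_v x t v = vector_derivative (\<lambda>w. x t w) (at v)"

definition unit_normal :: "surface \<Rightarrow> surface" where
  "unit_normal x t v =
     cross3 (partial_t x t v) (partial_v x t v) /\<^sub>R norm (cross3 (partial_t x t v) (partial_v x t v))"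

definition coeff_E :: "surface \<Rightarrow> real \<Rightarrow> real \<Rightarrow> real" where
  "coeff_E x t v = partial_t x t v \<bullet> partial_t x t v"

definition coeff_F :: "surface \<Rightarrow> real \<Rightarrow> real \<Rightarrow> real" where
  "coeff_F x t v = partial_t x t v \<bullet> partial_v x t v"

definition coeff_G :: "surface \<Rightarrow> real \<Rightarrow> real \<Rightarrow> real" where
  "coeff_G x t v = partial_v x t v \<bullet> partial_v x t v"

definition coeff_L :: "surface \<Rightarrow> real \<Rightarrow> real \<Rightarrow> real" where
  "coeff_L x t v = partial_t (partial_t x) t v \<bullet> unit_normal x t v"

definition coeff_M :: "surface \<Rightarrow> real \<Rightarrow> real \<Rightarrow> real" where
  "coeff_M x t v = partial_v (partial_t x) t v \<bullet> unit_normal x t v"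

definition coeff_N :: "surface \<Rightarrow> real \<Rightarrow> real \<Rightarrow> real" where
  "coeff_N x t v = partial_v (partial_v x) t v \<bullet> unit_normal x t v"

text \<open>The following formulas, and the area density below, presuppose \<open>F = M = 0\<close>,
  as holds for surfaces of revolution.\<close>

definition curvature_k1 :: "surface \<Rightarrow> real \<Rightarrow> real \<Rightarrow> real" where
  "curvature_k1 x t v = coeff_L x t v / coeff_E x t v"

definition curvature_k2 :: "surface \<Rightarrow> real \<Rightarrow> real \<Rightarrow> real" where
  "curvature_k2 x t v = coeff_N x t v / coeff_G x t v"

definition mean_curvature :: "surface \<Rightarrow> real \<Rightarrow> real \<Rightarrow> real" where
  "mean_curvature x t v = (curvature_k1 x t v + curvature_k2 x t v) / 2"

definition Gaussian_curvature :: "surface \<Rightarrow> real \<Rightarrow> real \<Rightarrow> real" where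
  "Gaussian_curvature x t v =
     (coeff_L x t v * coeff_N x t v) / (coeff_E x t v * coeff_G x t v)"

definition area_density :: "surface \<Rightarrow> real \<Rightarrow> real \<Rightarrow> real" where
  "area_density x t v = norm (partial_t x t v) * norm (partial_v x t v)"

definition arc_length_parametrized :: "(real \<Rightarrow> real ^ 3) \<Rightarrow> bool" where
  "arc_length_parametrized \<alpha> \<longleftrightarrow>
     (\<forall>s. \<alpha> differentiable (at s) \<and> norm (vector_derivative \<alpha> (at s)) = 1)"

text \<open>A curve in the surface is given by its parameter curve \<open>\<gamma>\<close>, that is \<open>\<alpha> = x \<circ> \<gamma>\<close>;
  the formula is the geodesic curvature when \<open>\<alpha>\<close> is parametrized by arc length.\<close>

definition geodesic_curvature :: "surface \<Rightarrow> (real \<Rightarrow> real \<times> real) \<Rightarrow> real \<Rightarrow> real" where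
  "geodesic_curvature x \<gamma> s =
     (let \<alpha> = (\<lambda>r. x (fst (\<gamma> r)) (snd (\<gamma> r)));
          t = fst (\<gamma> s);
          v = snd (\<gamma> s);
          u = (THE u. u \<in> span {partial_t x t v, partial_v x t v} \<and> norm u = 1 \<and>
                      cross3 (vector_derivative \<alpha> (at s)) u = unit_normal x t v)
      in vector_derivative (\<lambda>r. vector_derivative \<alpha> (at r)) (at s) \<bullet> u)"

text \<open>\<open>\<phi>\<close> is an arc-length reparametrization of the parallel \<open>v \<mapsto> x(t, v)\<close>
  that preserves its orientation.\<close>

definition arc_length_parallel :: "surface \<Rightarrow> real \<Rightarrow> (real \<Rightarrow> real) \<Rightarrow> bool" where
  "arc_length_parallel x t \<phi> \<longleftrightarrow>
     (\<forall>s. \<exists>d>0. (\<phi> has_real_derivative d) (at s)) \<and>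
     arc_length_parametrized (\<lambda>s. x t (\<phi> s))"

definition hyperbola :: "real \<Rightarrow> real \<Rightarrow> (real \<times> real) set" where
  "hyperbola a b = {(x, y). x\<^sup>2 / a\<^sup>2 - y\<^sup>2 / b\<^sup>2 = 1}"

text \<open>The transverse axis (the line through the foci) of this hyperbola is \<open>y = 0\<close>;
  the vertices are the points where the hyperbola meets it.\<close>

definition hyperbola_vertices :: "real \<Rightarrow> real \<Rightarrow> (real \<times> real) set" where
  "hyperbola_vertices a b = hyperbola a b \<inter> {(x, y). y = 0}"

end

theory Submission
  imports Defs
begin

text \<open>
  The profile curve satisfies \<open>(f', g') = h \<cdot> (c sinh t, b)\<close> with \<open>h > 0\<close>, and its speed is
  \<open>h sqrt (c\<^sup>2 cosh\<^sup>2 t - a\<^sup>2)\<close> because \<open>c\<^sup>2 = a\<^sup>2 + b\<^sup>2\<close>. Since the direction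
  \<open>(c sinh t, b)\<close> has the simple derivative \<open>(c cosh t, 0)\<close>, the terms with \<open>h'\<close> cancel in
  \<open>f' g'' - f'' g'\<close>, and the usual formulas for surfaces of revolution give everything without
  computing \<open>h'\<close>. The density \<open>K |x_t| |x_v|\<close> depends on \<open>t\<close> only and is \<open>- c\<close> times the derivative of
  \<open>sinh t / sqrt (c\<^sup>2 cosh\<^sup>2 t - a\<^sup>2)\<close>.
\<close>

section \<open>Vectors with three explicit coordinates, and circle identities\<close>

lemma has_vector_derivative_vector_3:
  fixes p q r :: "real \<Rightarrow> real"
  assumes "(p has_real_derivative p') (at t)" "(q has_real_derivative q') (at t)"
    and "(r has_real_derivative r') (at t)"
  shows "((\<lambda>s. vector [p s, q s, r s] :: real ^ 3) has_vector_derivative vector [p', q', r']) (at t)"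
proof -
  \<comment> \<open>In the axis basis the triple becomes a sum of constant vectors with scalar
    coefficients, which the standard derivative rules handle.\<close>
  have expand: "vector [x, y, z] = x *\<^sub>R axis 1 1 + y *\<^sub>R axis 2 1 + z *\<^sub>R (axis 3 1 :: real ^ 3)"
    for x y z :: real
    by (simp add: vec_eq_iff forall_3 axis_def)
  show ?thesis
    unfolding expand
    by (auto intro!: derivative_eq_intros assms)
qed

lemma inner_vector_3:
  "(vector [p, q, r] :: real ^ 3) \<bullet> vector [x, y, z] = p * x + q * y + r * z"
  by (simp add: inner_vec_def sum_3)

lemma cross3_vector_3:
  "cross3 (vector [p, q, r]) (vector [x, y, z]) = vector [q * z - r * y, r * x - p * z, p * y - q * x]"
  by (simp add: cross3_def)

lemma scaleR_vector_3: "k *\<^sub>R (vector [x, y, z] :: real ^ 3) = vector [k * x, k * y, k * z]"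
  by (simp add: vec_eq_iff forall_3)

lemma norm_vector_3: "norm (vector [x, y, z] :: real ^ 3) = sqrt (x\<^sup>2 + y\<^sup>2 + z\<^sup>2)"
  by (simp add: norm_eq_sqrt_inner inner_vector_3 power2_eq_square)

lemma cos_sin_squares: "(k * cos v)\<^sup>2 + (k * sin v)\<^sup>2 = k\<^sup>2" for k v :: real
  by (simp add: power_mult_distrib flip: distrib_left)

text \<open>The shape in which \<open>cos\<close> and \<open>sin\<close> squares arise in inner and
  cross products of vectors turning with the angle \<open>v\<close>; with it the dependence on
  \<open>v\<close> disappears.\<close>

lemma cos_sin_products:
  "k * cos v * (l * cos v) + k * sin v * (l * sin v) = k * l" for k l v :: real
proof -
  have "k * cos v * (l * cos v) + k * sin v * (l * sin v) = k * l * ((cos v)\<^sup>2 + (sin v)\<^sup>2)"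
    by algebra
  then show ?thesis by simp
qed

section \<open>Surfaces of revolution over a regular profile curve\<close>

text \<open>The derivatives are parameters, so the formulas below come out directly in whatever
  expressions an interpretation supplies. Regularity keeps the profile speed, by which the normal
  and the conormal are divided, away from zero.\<close>

locale regular_profile =
  fixes f g f' g' f'' g'' :: "real \<Rightarrow> real"
  assumes f_pos: "f t > 0"
    and DERIV_f: "(f has_real_derivative f' t) (at t)"
    and DERIV_g: "(g has_real_derivative g' t) (at t)"
    and DERIV_f': "(f' has_real_derivative f'' t) (at t)"
    and DERIV_g': "(g' has_real_derivative g'' t) (at t)"
    and regular: "(f' t)\<^sup>2 + (g' t)\<^sup>2 > 0"
begin

abbreviation S :: surface where
  "S \<equiv> surface_of_revolution f g"

lemma has_vector_derivative_t:
  "((\<lambda>s. S s v) has_vector_derivative vector [f' t * cos v, f' t * sin v, g' t]) (at t)"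
  unfolding surface_of_revolution_def
  by (intro has_vector_derivative_vector_3)
    (auto intro!: derivative_eq_intros DERIV_f DERIV_g)

lemma has_vector_derivative_v:
  "((\<lambda>w. S t w) has_vector_derivative vector [- f t * sin v, f t * cos v, 0]) (at v)"
  unfolding surface_of_revolution_def
  by (intro has_vector_derivative_vector_3) (auto intro!: derivative_eq_intros)

lemma partial_t_eq: "partial_t S = (\<lambda>t v. vector [f' t * cos v, f' t * sin v, g' t])"
  by (auto simp: partial_t_def fun_eq_iff intro!: vector_derivative_at has_vector_derivative_t)

lemma partial_v_eq: "partial_v S = (\<lambda>t v. vector [- f t * sin v, f t * cos v, 0])"
  unfolding partial_v_def fun_eq_iff
  by (intro allI vector_derivative_at has_vector_derivative_v)

lemma partial_tt: "partial_t (partial_t S) t v = vector [f'' t * cos v, f'' t * sin v, g'' t]"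
  unfolding partial_t_eq partial_t_def
  by (intro vector_derivative_at has_vector_derivative_vector_3)
    (auto intro!: derivative_eq_intros DERIV_f' DERIV_g')

lemma partial_tv: "partial_v (partial_t S) t v = vector [- f' t * sin v, f' t * cos v, 0]"
  unfolding partial_t_eq partial_v_def
  by (intro vector_derivative_at has_vector_derivative_vector_3) (auto intro!: derivative_eq_intros)

lemma partial_vv: "partial_v (partial_v S) t v = vector [- f t * cos v, - f t * sin v, 0]"
  unfolding partial_v_eq unfolding partial_v_def
  by (intro vector_derivative_at has_vector_derivative_vector_3) (auto intro!: derivative_eq_intros)

text \<open>The cross product of the partial derivatives carries the positive factor
  \<open>f t\<close>, which cancels on normalization; only the profile speed remains.\<close>

lemma unit_normal_eq:
  "unit_normal S t v = (1 / sqrt ((f' t)\<^sup>2 + (g' t)\<^sup>2)) *\<^sub>R vector [- g' t * cos v, - g' t * sin v, f' t]"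
proof -
  have "f' t * cos v * (f t * cos v) + f' t * sin v * (f t * sin v) = f' t * f t"
    by (rule cos_sin_products)
  then have cross: "cross3 (partial_t S t v) (partial_v S t v) =
      f t *\<^sub>R vector [- g' t * cos v, - g' t * sin v, f' t]"
    by (simp add: partial_t_eq partial_v_eq cross3_vector_3 scaleR_vector_3 algebra_simps)
  have "norm (vector [- g' t * cos v, - g' t * sin v, f' t] :: real ^ 3) = sqrt ((f' t)\<^sup>2 + (g' t)\<^sup>2)"
    unfolding norm_vector_3 cos_sin_squares by (simp add: add.commute)
  with cross show ?thesis
    using f_pos[of t] by (simp add: unit_normal_def divide_simps)
qed

lemma coeff_E_eq: "coeff_E S t v = (f' t)\<^sup>2 + (g' t)\<^sup>2"
  by (simp add: coeff_E_def partial_t_eq inner_vector_3 cos_sin_products power2_eq_square)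

lemma coeff_F_eq: "coeff_F S t v = 0"
  by (simp add: coeff_F_def partial_t_eq partial_v_eq inner_vector_3)

lemma coeff_G_eq: "coeff_G S t v = (f t)\<^sup>2"
  using cos_sin_products[of "f t" v "f t"]
  by (simp add: coeff_G_def partial_v_eq inner_vector_3 power2_eq_square)

lemma coeff_L_eq:
  "coeff_L S t v = (f' t * g'' t - f'' t * g' t) / sqrt ((f' t)\<^sup>2 + (g' t)\<^sup>2)"
proof -
  have "partial_t (partial_t S) t v \<bullet> vector [- g' t * cos v, - g' t * sin v, f' t] =
      f' t * g'' t - f'' t * g' t"
    using cos_sin_products[of "f'' t" v "g' t"] by (simp add: partial_tt inner_vector_3 mult.commute)
  then show ?thesis by (simp add: coeff_L_def unit_normal_eq)
qed

lemma coeff_M_eq: "coeff_M S t v = 0"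
  by (simp add: coeff_M_def partial_tv unit_normal_eq inner_vector_3)

lemma coeff_N_eq: "coeff_N S t v = f t * g' t / sqrt ((f' t)\<^sup>2 + (g' t)\<^sup>2)"
  using cos_sin_products[of "f t" v "g' t"]
  by (simp add: coeff_N_def partial_vv unit_normal_eq inner_vector_3)

lemma area_density_eq: "area_density S t v = sqrt ((f' t)\<^sup>2 + (g' t)\<^sup>2) * f t"
  using f_pos[of t] coeff_E_eq[of t v] coeff_G_eq[of t v]
  by (simp add: area_density_def coeff_E_def coeff_G_def norm_eq_sqrt_inner)

lemma has_vector_derivative_parallel:
  assumes "(\<phi> has_real_derivative d) (at s)"
  shows "((\<lambda>r. S t (\<phi> r)) has_vector_derivative
    vector [- (f t * d) * sin (\<phi> s), f t * d * cos (\<phi> s), 0]) (at s)"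
  unfolding surface_of_revolution_def
  by (intro has_vector_derivative_vector_3) (auto intro!: derivative_eq_intros assms)

lemma norm_circle_tangent: "norm (vector [- k * sin v, k * cos v, 0] :: real ^ 3) = \<bar>k\<bar>"
  using cos_sin_squares[of k v] by (simp add: norm_vector_3 add.commute)

lemma ex_arc_length_parallel: "\<exists>\<phi>. arc_length_parallel S t \<phi>"
proof
  \<comment> \<open>The parallel is a circle of radius \<open>f t\<close>, so arc length
    \<open>s\<close> corresponds to the angle \<open>s / f t\<close>.\<close>
  let ?\<phi> = "\<lambda>s. s / f t"
  have \<phi>: "(?\<phi> has_real_derivative 1 / f t) (at s)" for s
    using f_pos[of t] by (auto intro!: derivative_eq_intros)
  have D: "((\<lambda>r. S t (?\<phi> r)) has_vector_derivative
      vector [- 1 * sin (?\<phi> s), 1 * cos (?\<phi> s), 0]) (at s)" for s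
    using has_vector_derivative_parallel[OF \<phi>, of t] f_pos[of t] by simp
  show "arc_length_parallel S t ?\<phi>"
    unfolding arc_length_parallel_def arc_length_parametrized_def
  proof (intro conjI allI)
    show "\<exists>d>0. (?\<phi> has_real_derivative d) (at s)" for s
      using \<phi> f_pos[of t] by (intro exI[of _ "1 / f t"]) auto
    show "(\<lambda>s. S t (?\<phi> s)) differentiable at s" for s
      using D by (rule differentiableI_vector)
    show "norm (vector_derivative (\<lambda>s. S t (?\<phi> s)) (at s)) = 1" for s
      unfolding vector_derivative_at[OF D] norm_circle_tangent by simp
  qed
qed

text \<open>Unit speed fixes \<open>f t * d\<close> up to sign, and preserved orientation fixes the
  sign. Hence the geodesic curvature is the same for every admissible parametrization.\<close>

lemma arc_length_parallel_derivative:
  assumes "arc_length_parallel S t \<phi>"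
  shows "(\<phi> has_real_derivative 1 / f t) (at s)"
proof -
  obtain d where d: "d > 0" "(\<phi> has_real_derivative d) (at s)"
    using assms by (auto simp: arc_length_parallel_def)
  have "norm (vector_derivative (\<lambda>s. S t (\<phi> s)) (at s)) = 1"
    using assms by (simp add: arc_length_parallel_def arc_length_parametrized_def)
  then have "\<bar>f t * d\<bar> = 1"
    unfolding vector_derivative_at[OF has_vector_derivative_parallel[OF d(2)]] norm_circle_tangent .
  then have "d = 1 / f t"
    using d f_pos[of t] by (simp add: abs_mult field_simps)
  with d show ?thesis by simp
qed

text \<open>Here \<open>e\<close> is the unit tangent of the parallel. A tangent unit vector
  orthogonal to it is plus or minus the normalized \<open>partial_t S t v\<close>; the cross product
  of \<open>e\<close> with that vector is minus the normal, which selects the minus sign.\<close>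

lemma conormal_of_parallel:
  fixes t v :: real
  defines "e \<equiv> vector [- sin v, cos v, 0] :: real ^ 3"
  shows "(THE u. u \<in> span {partial_t S t v, partial_v S t v} \<and> norm u = 1 \<and>
    cross3 e u = unit_normal S t v) = (- 1 / sqrt ((f' t)\<^sup>2 + (g' t)\<^sup>2)) *\<^sub>R partial_t S t v"
proof (rule the_equality)
  let ?X = "partial_t S t v" and ?Y = "partial_v S t v" and ?w = "sqrt ((f' t)\<^sup>2 + (g' t)\<^sup>2)"
  let ?n = "vector [- g' t * cos v, - g' t * sin v, f' t] :: real ^ 3"
  have w: "?w > 0" using regular[of t] by simp
  have norm_X: "norm ?X = ?w"
    using coeff_E_eq[of t v] by (simp add: coeff_E_def norm_eq_sqrt_inner)
  have norm_n: "norm ?n = ?w"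
    unfolding norm_vector_3 cos_sin_squares by (simp add: add.commute)
  have Y: "?Y = f t *\<^sub>R e"
    by (simp add: partial_v_eq e_def scaleR_vector_3)
  have eX: "cross3 e ?X = - ?n"
    using cos_sin_products[of "f' t" v 1]
    by (simp add: e_def partial_t_eq cross3_vector_3 vec_eq_iff forall_3 algebra_simps)
  show "(- 1 / ?w) *\<^sub>R ?X \<in> span {?X, ?Y} \<and> norm ((- 1 / ?w) *\<^sub>R ?X) = 1 \<and>
      cross3 e ((- 1 / ?w) *\<^sub>R ?X) = unit_normal S t v"
  proof (intro conjI)
    show "(- 1 / ?w) *\<^sub>R ?X \<in> span {?X, ?Y}"
      by (intro span_scale span_base) simp
    have unit_scale: "\<bar>- 1 / w\<bar> * w = 1" if "w > 0" for w :: real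
      using that by simp
    show "norm ((- 1 / ?w) *\<^sub>R ?X) = 1"
      unfolding norm_scaleR norm_X using w unit_scale by blast
    show "cross3 e ((- 1 / ?w) *\<^sub>R ?X) = unit_normal S t v"
      unfolding cross_mult_right eX unit_normal_eq by simp
  qed
  \<comment> \<open>Uniqueness: \<open>?Y\<close> is parallel to \<open>e\<close>, so the cross
    product sees only the \<open>?X\<close> coefficient \<open>k\<close> and determines it. As
    \<open>F = 0\<close> and the \<open>?X\<close> component already has length one, the unit norm
    leaves nothing for \<open>l\<close>.\<close>
  fix u assume u: "u \<in> span {?X, ?Y} \<and> norm u = 1 \<and> cross3 e u = unit_normal S t v"
  then obtain k l where ukl: "u = k *\<^sub>R ?X + l *\<^sub>R ?Y"
    by (auto simp: span_insert eq_diff_eq span_singleton algebra_simps)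
  have "cross3 e u = (- k) *\<^sub>R ?n"
    by (simp add: ukl Y cross_add_right cross_mult_right eX)
  then have "(- k) *\<^sub>R ?n = (1 / ?w) *\<^sub>R ?n"
    using u by (simp add: unit_normal_eq)
  moreover have "?n \<noteq> 0" using norm_n w by force
  ultimately have k: "k = - 1 / ?w"
    unfolding scaleR_cancel_right by simp
  have "1 = u \<bullet> u" using u by (simp add: norm_eq_1)
  also have "\<dots> = k\<^sup>2 * coeff_E S t v + l\<^sup>2 * coeff_G S t v + 2 * k * l * coeff_F S t v"
    by (simp add: ukl coeff_E_def coeff_F_def coeff_G_def inner_commute algebra_simps power2_eq_square)
  also have "\<dots> = 1 + l\<^sup>2 * (f t)\<^sup>2"
  proof -
    have "k\<^sup>2 * ?w\<^sup>2 = 1" using less_imp_neq[OF w] by (simp only: k power_divide) simp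
    then show ?thesis by (simp add: coeff_E_eq coeff_F_eq coeff_G_eq)
  qed
  finally have "l = 0" using f_pos[of t] by simp
  then show "u = (- 1 / ?w) *\<^sub>R ?X" using ukl k by simp
qed

lemma geodesic_curvature_parallel:
  assumes "arc_length_parallel S t \<phi>"
  shows "geodesic_curvature S (\<lambda>r. (t, \<phi> r)) s = f' t / (f t * sqrt ((f' t)\<^sup>2 + (g' t)\<^sup>2))"
proof -
  have \<phi>: "(\<phi> has_real_derivative 1 / f t) (at s)" for s
    using assms by (rule arc_length_parallel_derivative)
  have D1: "vector_derivative (\<lambda>r. S t (\<phi> r)) (at s) = vector [- sin (\<phi> s), cos (\<phi> s), 0]" for s
    using has_vector_derivative_parallel[OF \<phi>, of t] f_pos[of t] by (auto intro!: vector_derivative_at)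
  \<comment> \<open>The acceleration of the unit-speed circle points to the axis and has length
    \<open>1 / f t\<close>; its component along the conormal is the geodesic curvature.\<close>
  have D2: "vector_derivative (\<lambda>r. vector [- sin (\<phi> r), cos (\<phi> r), 0] :: real ^ 3) (at s) =
      vector [- (1 / f t) * cos (\<phi> s), - (1 / f t) * sin (\<phi> s), 0]"
    by (intro vector_derivative_at has_vector_derivative_vector_3)
      (auto intro!: derivative_eq_intros \<phi>)
  have inner: "vector [- (1 / f t) * cos (\<phi> s), - (1 / f t) * sin (\<phi> s), 0] \<bullet> partial_t S t (\<phi> s)
      = - (f' t / f t)"
    using cos_sin_products[of "1 / f t" "\<phi> s" "f' t"] by (simp add: partial_t_eq inner_vector_3)
  show ?thesis
    unfolding geodesic_curvature_def Let_def fst_conv snd_conv D1 D2 conormal_of_parallel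
      inner_scaleR_right inner
    by simp
qed

end

section \<open>The nodoid profile and its derivatives\<close>

locale nodoid_profile =
  fixes a b c :: real
  assumes a_pos: "a > 0" and b_pos: "b > 0" and c_eq: "c = sqrt (a\<^sup>2 + b\<^sup>2)"
begin

abbreviation Q :: "real \<Rightarrow> real" where
  "Q t \<equiv> sqrt (c\<^sup>2 * (cosh t)\<^sup>2 - a\<^sup>2)"

definition h :: "real \<Rightarrow> real" where
  "h t = a * b / (Q t * (c * cosh t + a))"

lemma c_squared: "c\<^sup>2 = a\<^sup>2 + b\<^sup>2"
  by (simp add: c_eq)

lemma c_pos: "c > 0"
  using a_pos by (simp add: c_eq add_pos_nonneg)

text \<open>Since \<open>b > 0\<close> gives \<open>a < c\<close> and \<open>cosh\<close> is at
  least 1, every denominator and radicand that follows is positive.\<close>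

lemma a_less_c_cosh: "a < c * cosh t"
proof -
  have "a\<^sup>2 < c\<^sup>2" using b_pos by (simp add: c_squared)
  then have "a < c" using c_pos by (simp add: power2_less_imp_less)
  also have "c \<le> c * cosh t" using c_pos cosh_real_ge_1[of t] by simp
  finally show ?thesis .
qed

lemma c_cosh_bounds: "c * cosh t - a > 0" "c * cosh t + a > 0"
  using a_less_c_cosh[of t] a_pos by linarith+

lemma radicand_factor: "c\<^sup>2 * (cosh t)\<^sup>2 - a\<^sup>2 = (c * cosh t - a) * (c * cosh t + a)"
  by algebra

text \<open>This form shows \<open>Q t\<close> to be the length of \<open>(c sinh t, b)\<close>, the
  direction of the profile curve.\<close>

lemma radicand_sinh: "c\<^sup>2 * (cosh t)\<^sup>2 - a\<^sup>2 = c\<^sup>2 * (sinh t)\<^sup>2 + b\<^sup>2"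
  by (simp add: cosh_square_eq c_squared algebra_simps)

lemma radicand_pos: "c\<^sup>2 * (cosh t)\<^sup>2 - a\<^sup>2 > 0"
  unfolding radicand_factor by (intro mult_pos_pos c_cosh_bounds)

lemma Q_pos: "Q t > 0"
  using radicand_pos by simp

lemma Q_squared: "(Q t)\<^sup>2 = c\<^sup>2 * (cosh t)\<^sup>2 - a\<^sup>2"
  using radicand_pos[of t] by simp

lemma h_pos: "h t > 0"
  unfolding h_def by (intro divide_pos_pos mult_pos_pos a_pos b_pos Q_pos c_cosh_bounds)

lemma DERIV_Q: "(Q has_real_derivative c\<^sup>2 * cosh t * sinh t / Q t) (at t)"
  using radicand_pos[of t] by (auto intro!: derivative_eq_intros simp: field_simps)

lemma DERIV_f:
  "((\<lambda>t. b * (c * cosh t - a) / Q t) has_real_derivative c * sinh t * h t) (at t)"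
proof -
  \<comment> \<open>Opaque names turn the computation into polynomial algebra, with
    \<open>q\<^sup>2 = w * p\<close> as the only relation for the root.\<close>
  define q w p C s where "q = Q t" and "w = c * cosh t - a" and "p = c * cosh t + a"
    and "C = cosh t" and "s = sinh t"
  note defs = this
  have pos: "q > 0" "p > 0" using Q_pos c_cosh_bounds by (simp_all add: defs)
  have q: "q\<^sup>2 = w * p" using Q_squared radicand_factor by (simp add: defs)
  have w: "w = c * C - a" and p: "p = c * C + a" by (simp_all add: defs)
  have "((\<lambda>t. b * (c * cosh t - a) / Q t) has_real_derivative
      (b * (c * s) * q - b * w * (c\<^sup>2 * C * s / q)) / (q * q)) (at t)"
    unfolding defs using Q_pos[of t]
    by (intro DERIV_divide DERIV_Q) (auto intro!: derivative_eq_intros)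
  also have "b * (c * s) * q - b * w * (c\<^sup>2 * C * s / q) = a * b * c * s * w / q"
  proof -
    \<comment> \<open>Multiplying by \<open>q\<close> removes the root: after replacing
      \<open>q\<^sup>2\<close> by \<open>w * p\<close>, the factor \<open>p - c * C = a\<close> is
      left.\<close>
    have "b * (c * s) * q\<^sup>2 - b * w * (c\<^sup>2 * C * s) = a * b * c * s * w"
      unfolding q w p by algebra
    then show ?thesis using pos by (simp add: field_simps power2_eq_square)
  qed
  also have "a * b * c * s * w / q / (q * q) = c * sinh t * h t"
  proof -
    have "h t = a * b / (q * p)" and "w = q * q / p"
      using pos q by (simp_all add: h_def defs power2_eq_square field_simps)
    then show ?thesis using pos by (simp add: defs(5) mult_ac)
  qed
  finally show ?thesis .
qed

lemma DERIV_elliptic_integral: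
  "((\<lambda>t. LBINT z=ereal t0..ereal t. Q z) has_real_derivative Q t) (at t)"
proof -
  \<comment> \<open>The margin 1 puts \<open>t\<close> in the interior of a compact interval that
    also contains \<open>t0\<close>, so the derivative within the interval is the two-sided one,
    whichever of the two points is larger.\<close>
  define l u where "l = min t0 t - 1" and "u = max t0 t + 1"
  have "((\<lambda>t. LBINT z=ereal t0..ereal t. Q z) has_vector_derivative Q t) (at t within {l..u})"
    by (intro interval_integral_FTC2) (auto simp: l_def u_def intro!: continuous_intros)
  moreover have "at t within {l..u} = at t"
    by (intro at_within_Icc_at) (auto simp: l_def u_def)
  ultimately show ?thesis
    by (simp add: has_real_derivative_iff_has_vector_derivative)
qed

lemma DERIV_g:
  "((\<lambda>t. (LBINT z=ereal t0..ereal t. Q z) - c * sinh t * (c * cosh t - a) / Q t)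
    has_real_derivative b * h t) (at t)"
proof -
  define q w p C s where "q = Q t" and "w = c * cosh t - a" and "p = c * cosh t + a"
    and "C = cosh t" and "s = sinh t"
  note defs = this
  have pos: "q > 0" "p > 0" using Q_pos c_cosh_bounds by (simp_all add: defs)
  have q: "q\<^sup>2 = w * p" using Q_squared radicand_factor by (simp add: defs)
  have w: "w = c * C - a" and p: "p = c * C + a" by (simp_all add: defs)
  have C: "C\<^sup>2 = s\<^sup>2 + 1" by (simp add: defs cosh_square_eq)
  have "((\<lambda>t. (LBINT z=ereal t0..ereal t. Q z) - c * sinh t * (c * cosh t - a) / Q t)
      has_real_derivative
      q - ((c * C * w + c * s * (c * s)) * q - c * s * w * (c\<^sup>2 * C * s / q)) / (q * q)) (at t)"
    unfolding defs using Q_pos[of t]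
    by (intro DERIV_diff DERIV_elliptic_integral DERIV_divide DERIV_Q)
      (auto intro!: derivative_eq_intros)
  also have "q - ((c * C * w + c * s * (c * s)) * q - c * s * w * (c\<^sup>2 * C * s / q)) / (q * q)
      = a * b\<^sup>2 / (q * p)"
  proof -
    have "w * p = c\<^sup>2 * s\<^sup>2 + b\<^sup>2"
      using C c_squared unfolding w p by algebra
    \<comment> \<open>With \<open>q\<^sup>2 = w * p\<close> the left side factors as
      \<open>w * (p - c * C) * (w * p - c\<^sup>2 * s\<^sup>2)\<close>, whose last two factors are
      \<open>a\<close> and \<open>b\<^sup>2\<close>.\<close>
    then have *: "(q\<^sup>2 * q\<^sup>2 - (c * C * w + c * s * (c * s)) * q\<^sup>2 + c * s * w * (c\<^sup>2 * C * s)) = a * b\<^sup>2 * w"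
      unfolding q unfolding w p by algebra
    have "q - ((c * C * w + c * s * (c * s)) * q - c * s * w * (c\<^sup>2 * C * s / q)) / (q * q)
      = (q\<^sup>2 * q\<^sup>2 - (c * C * w + c * s * (c * s)) * q\<^sup>2 + c * s * w * (c\<^sup>2 * C * s)) / (q * q\<^sup>2)"
      using pos by (simp add: field_simps power2_eq_square)
    also have "\<dots> = a * b\<^sup>2 * w / (q * q\<^sup>2)" unfolding * ..
    also have "\<dots> = a * b\<^sup>2 / (q * p)"
      using pos q by (auto simp: divide_simps)
    finally show ?thesis .
  qed
  also have "a * b\<^sup>2 / (q * p) = b * h t"
    by (simp add: h_def defs power2_eq_square)
  finally show ?thesis .
qed

text \<open>Supplies the \<open>h'\<close> occurring in the second derivatives of the profile,
  without a closed form.\<close>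

lemma h_differentiable: "\<exists>h'. \<forall>t. (h has_real_derivative h' t) (at t)"
proof -
  have "\<exists>D. (h has_real_derivative D) (at t)" for t
    unfolding h_def using Q_pos[of t] c_cosh_bounds[of t]
    by (intro exI DERIV_divide DERIV_mult' DERIV_Q) (auto intro!: derivative_eq_intros)
  then show ?thesis by metis
qed

text \<open>Provides the antiderivative for the total curvature; the numerator simplifies because
  \<open>Q\<^sup>2\<close> exceeds \<open>c\<^sup>2 * (sinh t)\<^sup>2\<close> by exactly
  \<open>b\<^sup>2\<close>.\<close>

lemma DERIV_sinh_div_Q:
  "((\<lambda>t. sinh t / Q t) has_real_derivative b\<^sup>2 * cosh t / Q t ^ 3) (at t)"
proof -
  have "((\<lambda>t. sinh t / Q t) has_real_derivative
      (cosh t * Q t - sinh t * (c\<^sup>2 * cosh t * sinh t / Q t)) / (Q t * Q t)) (at t)"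
    using Q_pos[of t] by (intro DERIV_divide DERIV_Q) (auto intro!: derivative_eq_intros)
  also have "(cosh t * Q t - sinh t * (c\<^sup>2 * cosh t * sinh t / Q t)) / (Q t * Q t)
      = cosh t * ((Q t)\<^sup>2 - c\<^sup>2 * (sinh t)\<^sup>2) / Q t ^ 3"
    \<comment> \<open>The deleted rule would turn \<open>Q t * Q t\<close> into the absolute value
      of the radicand and so break up the powers of \<open>Q t\<close>.\<close>
    using Q_pos[of t] by (simp add: field_simps power2_eq_square power3_eq_cube del: real_sqrt_mult_self)
  also have "(Q t)\<^sup>2 - c\<^sup>2 * (sinh t)\<^sup>2 = b\<^sup>2"
    unfolding Q_squared radicand_sinh by simp
  finally show ?thesis by (simp add: mult.commute)
qed

lemma profile_speed: "sqrt ((c * sinh t * h t)\<^sup>2 + (b * h t)\<^sup>2) = Q t * h t"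
proof -
  have "(c * sinh t * h t)\<^sup>2 + (b * h t)\<^sup>2 = (Q t * h t)\<^sup>2"
    unfolding power_mult_distrib Q_squared unfolding radicand_sinh by algebra
  then show ?thesis using Q_pos[of t] h_pos[of t] by simp
qed

end

section \<open>Vertices of the hyperbola, and integration over a rectangle\<close>

lemma hyperbola_vertices_eq:
  assumes "a > 0"
  shows "hyperbola_vertices a b = {(a, 0), (- a, 0)}"
  using assms by (auto simp: hyperbola_vertices_def hyperbola_def divide_simps power2_eq_iff)

text \<open>Fubini for a continuous integrand independent of \<open>v\<close>: the inner integral
  contributes the factor \<open>v2 - v1\<close>, and the fundamental theorem of calculus evaluates
  the outer one.\<close>

lemma has_integral_fst_rectangle:
  fixes \<kappa> K :: "real \<Rightarrow> real"
  assumes "t1 \<le> t2" "v1 \<le> v2"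
    and \<kappa>: "continuous_on {t1..t2} \<kappa>"
    and K: "\<And>t. t \<in> {t1..t2} \<Longrightarrow> (K has_real_derivative \<kappa> t) (at t within {t1..t2})"
  shows "((\<lambda>(t, v). \<kappa> t) has_integral (v2 - v1) * (K t2 - K t1)) ({t1..t2} \<times> {v1..v2})"
proof -
  let ?R = "cbox (t1, v1) (t2, v2)"
  have R: "?R = {t1..t2} \<times> {v1..v2}" by (simp add: cbox_Pair_eq)
  have cont: "continuous_on ?R (\<lambda>(t, v). \<kappa> t)"
    unfolding R case_prod_beta
    by (rule continuous_on_compose2[OF \<kappa>]) (auto intro!: continuous_intros)
  have "integral ?R (\<lambda>(t, v). \<kappa> t) = integral {t1..t2} (\<lambda>t. (v2 - v1) * \<kappa> t)"
    using integral_prod_continuous[OF cont] assms(2) by simp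
  also have "\<dots> = (v2 - v1) * integral {t1..t2} \<kappa>"
    by simp
  also have "integral {t1..t2} \<kappa> = K t2 - K t1"
    using assms(1) K
    by (intro integral_unique fundamental_theorem_of_calculus)
      (auto simp: has_real_derivative_iff_has_vector_derivative)
  finally show ?thesis
    using integrable_integral[OF integrable_continuous[OF cont]] R by simp
qed

section \<open>Curvatures and total curvature of the nodoid\<close>

theorem mainTheorem6:
  fixes a b c t0 :: real and f g h1 :: "real \<Rightarrow> real" and z1 :: surface
  assumes "a > 0" and "b > 0"
    and "c = sqrt (a\<^sup>2 + b\<^sup>2)"
    and "\<And>t. f t = b * (c * cosh t - a) / sqrt (c\<^sup>2 * (cosh t)\<^sup>2 - a\<^sup>2)"
    and "\<And>t. g t = (LBINT z=ereal t0..ereal t. sqrt (c\<^sup>2 * (cosh z)\<^sup>2 - a\<^sup>2))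
                   - c * sinh t * (c * cosh t - a) / sqrt (c\<^sup>2 * (cosh t)\<^sup>2 - a\<^sup>2)"
    and "\<And>t. h1 t = a * b / (sqrt (c\<^sup>2 * (cosh t)\<^sup>2 - a\<^sup>2) * (c * cosh t + a))"
    and "z1 = surface_of_revolution f g"
  shows
    "(\<forall>t v.
        ((\<lambda>s. z1 s v) has_vector_derivative
           vector [c * sinh t * h1 t * cos v, c * sinh t * h1 t * sin v, b * h1 t]) (at t) \<and>
        ((\<lambda>w. z1 t w) has_vector_derivative
           vector [- f t * sin v, f t * cos v, 0]) (at v) \<and>
        unit_normal z1 t v =
          (1 / sqrt (c\<^sup>2 * (cosh t)\<^sup>2 - a\<^sup>2)) *\<^sub>R vector [- b * cos v, - b * sin v, c * sinh t] \<and>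
        coeff_E z1 t v = a\<^sup>2 * b\<^sup>2 / (c * cosh t + a)\<^sup>2 \<and> coeff_E z1 t v \<noteq> 0 \<and>
        coeff_F z1 t v = 0 \<and>
        coeff_G z1 t v = b\<^sup>2 * (c * cosh t - a) / (c * cosh t + a) \<and> coeff_G z1 t v \<noteq> 0 \<and>
        coeff_L z1 t v =
          - a * b\<^sup>2 * c * cosh t / ((c\<^sup>2 * (cosh t)\<^sup>2 - a\<^sup>2) * (c * cosh t + a)) \<and>
        coeff_L z1 t v \<noteq> 0 \<and>
        coeff_M z1 t v = 0 \<and>
        coeff_N z1 t v = b\<^sup>2 / (c * cosh t + a) \<and> coeff_N z1 t v \<noteq> 0 \<and>
        curvature_k1 z1 t v = - c * cosh t / (a * (c * cosh t - a)) \<and>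
        curvature_k2 z1 t v = 1 / (c * cosh t - a) \<and>
        mean_curvature z1 t v = - 1 / (2 * a) \<and>
        Gaussian_curvature z1 t v = - c * cosh t / (a * (c * cosh t - a)\<^sup>2)) \<and>
     (\<exists>p q. p \<noteq> q \<and> hyperbola_vertices a b = {p, q} \<and> dist p q = 2 * a \<and>
        (\<forall>t v. mean_curvature z1 t v = - inverse (dist p q))) \<and>
     (\<forall>t. (\<exists>\<phi>. arc_length_parallel z1 t \<phi>) \<and>
        (\<forall>\<phi> s. arc_length_parallel z1 t \<phi> \<longrightarrow>
           geodesic_curvature z1 (\<lambda>r. (t, \<phi> r)) s = c * sinh t / (b * (c * cosh t - a)))) \<and>
     (\<forall>t1 t2 v1 v2. t1 < t2 \<longrightarrow> v1 < v2 \<longrightarrow>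
        ((\<lambda>(t, v). Gaussian_curvature z1 t v * area_density z1 t v) has_integral
           - c * (v2 - v1) * (sinh t2 / sqrt (c\<^sup>2 * (cosh t2)\<^sup>2 - a\<^sup>2)
                            - sinh t1 / sqrt (c\<^sup>2 * (cosh t1)\<^sup>2 - a\<^sup>2)))
          ({t1..t2} \<times> {v1..v2}))"
proof -
  interpret nodoid_profile a b c
    using assms(1-3) by unfold_locales
  have h1: "h1 = h" by (simp add: fun_eq_iff h_def assms(6))
  obtain h' where h': "\<And>t. (h has_real_derivative h' t) (at t)"
    using h_differentiable by blast
  \<comment> \<open>The second derivatives are the product rule applied to \<open>h\<close> times
    \<open>(c sinh t, b)\<close>.\<close>
  interpret regular_profile f g "\<lambda>t. c * sinh t * h t" "\<lambda>t. b * h t"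
    "\<lambda>t. c * cosh t * h t + c * sinh t * h' t" "\<lambda>t. b * h' t"
  proof
    fix t
    show "f t > 0"
      unfolding assms(4) by (intro divide_pos_pos mult_pos_pos b_pos Q_pos c_cosh_bounds)
    show "(f has_real_derivative c * sinh t * h t) (at t)"
      using DERIV_f[of t] by (simp flip: assms(4))
    show "(g has_real_derivative b * h t) (at t)"
      using DERIV_g[of t0 t] by (simp flip: assms(5))
    show "((\<lambda>t. c * sinh t * h t) has_real_derivative c * cosh t * h t + c * sinh t * h' t) (at t)"
      by (auto intro!: derivative_eq_intros h')
    show "((\<lambda>t. b * h t) has_real_derivative b * h' t) (at t)"
      by (auto intro!: derivative_eq_intros h')
    show "(c * sinh t * h t)\<^sup>2 + (b * h t)\<^sup>2 > 0"
      using b_pos h_pos[of t] by (simp add: add_nonneg_pos)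
  qed
  have z1: "z1 = S" by (fact assms(7))
  have f_eq: "f t = b * (c * cosh t - a) / Q t" for t by (fact assms(4))
  have f_squared: "(f t)\<^sup>2 = b\<^sup>2 * (c * cosh t - a) / (c * cosh t + a)" for t
    unfolding f_eq power_divide power_mult_distrib Q_squared unfolding radicand_factor
    using c_cosh_bounds[of t] by (simp add: power2_eq_square)
  have speed: "Q t * h t = a * b / (c * cosh t + a)" for t
    using Q_pos[of t] by (simp add: h_def)
  have nz: "c * cosh t - a \<noteq> 0" "c * cosh t + a \<noteq> 0" "cosh t \<noteq> 0"
    "h t \<noteq> 0" "Q t \<noteq> 0" for t
    using c_cosh_bounds[of t] h_pos[of t] Q_pos[of t] by auto
  note [simp] = less_imp_neq[OF a_pos, symmetric] less_imp_neq[OF b_pos, symmetric]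
    less_imp_neq[OF c_pos, symmetric]

  have normal: "unit_normal z1 t v = (1 / Q t) *\<^sub>R vector [- b * cos v, - b * sin v, c * sinh t]" for t v
    unfolding z1 unit_normal_eq profile_speed using nz
    by (simp add: scaleR_vector_3)
  have E: "coeff_E z1 t v = a\<^sup>2 * b\<^sup>2 / (c * cosh t + a)\<^sup>2" for t v
  proof -
    have "coeff_E z1 t v = (Q t * h t)\<^sup>2"
      unfolding z1 coeff_E_eq profile_speed[symmetric] by simp
    then show ?thesis by (simp add: speed power_divide power_mult_distrib)
  qed
  have G: "coeff_G z1 t v = b\<^sup>2 * (c * cosh t - a) / (c * cosh t + a)" for t v
    unfolding z1 coeff_G_eq by (fact f_squared)
  have L: "coeff_L z1 t v = - a * b\<^sup>2 * c * cosh t / ((Q t)\<^sup>2 * (c * cosh t + a))" for t v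
  proof -
    \<comment> \<open>Both products in the numerator contain
      \<open>b * c * sinh t * h t * h' t\<close>, which cancels.\<close>
    have "coeff_L z1 t v = - (b * c * cosh t) * h t * h t / (Q t * h t)"
      unfolding z1 coeff_L_eq profile_speed by (simp add: algebra_simps)
    also have "\<dots> = - (b * c * cosh t) / Q t * h t"
      using nz[of t] by simp
    also have "\<dots> = - a * b\<^sup>2 * c * cosh t / ((Q t)\<^sup>2 * (c * cosh t + a))"
      by (simp add: h_def power2_eq_square mult_ac del: real_sqrt_mult_self)
    finally show ?thesis .
  qed
  have N: "coeff_N z1 t v = b\<^sup>2 / (c * cosh t + a)" for t v
  proof -
    have "coeff_N z1 t v = f t * b / Q t"
      unfolding z1 coeff_N_eq profile_speed using nz[of t] by simp
    also have "\<dots> = b\<^sup>2 * (c * cosh t - a) / (Q t)\<^sup>2"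
      by (simp add: f_eq power2_eq_square del: real_sqrt_mult_self)
    finally show ?thesis
      unfolding Q_squared unfolding radicand_factor using nz[of t] by simp
  qed
  have k1: "curvature_k1 z1 t v = - c * cosh t / (a * (c * cosh t - a))" for t v
    unfolding curvature_k1_def L E Q_squared unfolding radicand_factor using nz[of t]
    by (simp add: power2_eq_square)
  have k2: "curvature_k2 z1 t v = 1 / (c * cosh t - a)" for t v
    unfolding curvature_k2_def N G using nz[of t] by simp
  have H: "mean_curvature z1 t v = - 1 / (2 * a)" for t v
  proof -
    \<comment> \<open>In terms of \<open>w\<close> the principal curvatures are
      \<open>- (w + a) / (a * w)\<close> and \<open>1 / w\<close>, with sum
      \<open>- 1 / a\<close>.\<close>
    define w where "w = c * cosh t - a"
    have "c * cosh t = w + a" "w \<noteq> 0" using nz[of t] by (simp_all add: w_def)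
    then show ?thesis
      by (simp add: mean_curvature_def k1 k2 flip: w_def) (simp add: field_simps)
  qed
  have K: "Gaussian_curvature z1 t v = - c * cosh t / (a * (c * cosh t - a)\<^sup>2)" for t v
  proof -
    have "Gaussian_curvature z1 t v = curvature_k1 z1 t v * curvature_k2 z1 t v"
      by (simp add: Gaussian_curvature_def curvature_k1_def curvature_k2_def)
    then show ?thesis by (simp add: k1 k2 power2_eq_square)
  qed

  have "((\<lambda>s. z1 s v) has_vector_derivative
        vector [c * sinh t * h1 t * cos v, c * sinh t * h1 t * sin v, b * h1 t]) (at t) \<and>
      ((\<lambda>w. z1 t w) has_vector_derivative vector [- f t * sin v, f t * cos v, 0]) (at v)" for t v
    unfolding z1 h1 using has_vector_derivative_t has_vector_derivative_v by blast
  moreover have "coeff_F z1 t v = 0" "coeff_M z1 t v = 0" for t v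
    unfolding z1 by (fact coeff_F_eq, fact coeff_M_eq)
  moreover have "coeff_E z1 t v \<noteq> 0" "coeff_G z1 t v \<noteq> 0" "coeff_L z1 t v \<noteq> 0" "coeff_N z1 t v \<noteq> 0" for t v
    unfolding E G L N using nz[of t] by simp_all
  moreover have "\<exists>p q. p \<noteq> q \<and> hyperbola_vertices a b = {p, q} \<and> dist p q = 2 * a \<and>
      (\<forall>t v. mean_curvature z1 t v = - inverse (dist p q))"
  proof (intro exI conjI allI)
    show "hyperbola_vertices a b = {(a, 0), (- a, 0)}"
      using a_pos by (rule hyperbola_vertices_eq)
    show "(a, 0 :: real) \<noteq> (- a, 0)" using a_pos by simp
    show d: "dist (a, 0 :: real) (- a, 0) = 2 * a"
      using a_pos by (simp add: dist_Pair_Pair dist_real_def real_sqrt_mult)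
    show "mean_curvature z1 t v = - inverse (dist (a, 0 :: real) (- a, 0))" for t v
      unfolding H d by (simp only: divide_inverse mult_minus_left mult_1)
  qed
  moreover have "\<exists>\<phi>. arc_length_parallel z1 t \<phi>" for t
    unfolding z1 by (rule ex_arc_length_parallel)
  moreover have "geodesic_curvature z1 (\<lambda>r. (t, \<phi> r)) s = c * sinh t / (b * (c * cosh t - a))"
    if "arc_length_parallel z1 t \<phi>" for t \<phi> s
    using geodesic_curvature_parallel[OF that[unfolded z1]] nz[of t]
    by (simp add: z1 profile_speed f_eq)
  moreover have "((\<lambda>(t, v). Gaussian_curvature z1 t v * area_density z1 t v) has_integral
      - c * (v2 - v1) * (sinh t2 / Q t2 - sinh t1 / Q t1)) ({t1..t2} \<times> {v1..v2})"
    if "t1 < t2" "v1 < v2" for t1 t2 v1 v2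
  proof -
    have density: "Gaussian_curvature z1 t v * area_density z1 t v =
        - c * (b\<^sup>2 * cosh t / Q t ^ 3)" for t v
    proof -
      define w p q where "w = c * cosh t - a" and "p = c * cosh t + a" and "q = Q t"
      have "area_density z1 t v = a * b / p * (b * w / q)"
        unfolding z1 area_density_eq profile_speed speed f_eq w_def p_def q_def ..
      moreover have "w \<noteq> 0" "p \<noteq> 0" "q \<noteq> 0"
        unfolding w_def p_def q_def by (fact nz)+
      \<comment> \<open>The product of curvature and area density has denominator
        \<open>q * w * p\<close> once a factor \<open>w\<close> cancels; this identifies it with the
        cube of \<open>Q t\<close>.\<close>
      moreover have "q ^ 3 = q * (w * p)"
        unfolding power3_eq_cube mult.assoc w_def p_def q_def radicand_factor[of t, symmetric]
        by (simp only: Q_squared flip: power2_eq_square[of "Q t"])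
      ultimately show ?thesis
        unfolding K w_def[symmetric] q_def[symmetric] by (simp add: power2_eq_square mult_ac)
    qed
    \<comment> \<open>The antiderivative in \<open>t\<close> is
      \<open>- c * (sinh t / Q t)\<close>.\<close>
    have "((\<lambda>(t, v). - c * (b\<^sup>2 * cosh t / Q t ^ 3)) has_integral
        (v2 - v1) * (- c * (sinh t2 / Q t2) - - c * (sinh t1 / Q t1))) ({t1..t2} \<times> {v1..v2})"
      using that nz(5)
      by (intro has_integral_fst_rectangle DERIV_cmult has_field_derivative_at_within[OF DERIV_sinh_div_Q])
        (auto intro!: continuous_intros)
    moreover have "(v2 - v1) * (- c * (sinh t2 / Q t2) - - c * (sinh t1 / Q t1)) =
        - c * (v2 - v1) * (sinh t2 / Q t2 - sinh t1 / Q t1)"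
      by algebra
    ultimately show ?thesis
      unfolding density by (simp only:)
  qed
  ultimately show ?thesis
    using normal E G L[unfolded Q_squared] N k1 k2 H K by (intro conjI allI impI) presburger+
qed

end
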